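(* There exist an absolute constant $\kappa>0$ and an integer $n_0$ such that for every number of agents $n\ge n_0$ there exist a probability distribution $\mathcal{D}$ over value vectors in $[0,1]^n$ and a number of items $m$ such that $\mathbb{E}_{\sigma\sim R(m,\mathcal{D})}[\mathrm{OPT}(\sigma)]>0$ and, for any online algorithm $\mathrm{ALG}$ (even one that knows $\mathcal{D}$ and $m$ in advance), $$\frac{\mathbb{E}_{\sigma\sim R(m,\mathcal{D})}[\mathrm{ALG}(\sigma)]}{\mathbb{E}_{\sigma\sim R(m,\mathcal{D})}[\mathrm{OPT}(\sigma)]}\ \le\ \frac{1}{e^{\kappa n}} .$$ In other words, in the i.i.d. arrival model the strict competitive ratio of any algorithm is at most $1/e^{\Omega(n)}$.
   Context: Setting (online max-min fair allocation, i.i.d. arrival). There are agents $N=\{1,\dots,n\}$; items $e_1,\dots,e_m$ arrive one by one, with value vectors $(v_1(e_j),\dots,v_n(e_j))\in[0,1]^n$ drawn independently from $\mathcal{D}$; $R(m,\mathcal{D})$ denotes the resulting distribution of input sequences. On arrival of an item its value vector is revealed and the item must be irrevocably given to one agent. Valuations are additive: $v_i(X)=\sum_{e\in X}v_i(e)$. An online algorithm (possibly randomized) decides based on the value vectors revealed so far (including that of the current item), its past decisions and internal randomness (and here possibly on $m$ and $\mathcal{D}$). $\mathrm{ALG}(\sigma)$ is $\min_{i\in N}v_i(A_i)$ for the allocation produced by the algorithm, and $\mathrm{OPT}(\sigma)$ is the maximum of $\min_{i\in N}v_i(A_i)$ over all allocations (partitions of the items into $n$ parts). The strict competitive ratio is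 $\inf_{m,\mathcal{D}}\mathbb{E}_{\sigma\sim R(m,\mathcal{D})}[\mathrm{ALG}(\sigma)]/\mathbb{E}_{\sigma\sim R(m,\mathcal{D})}[\mathrm{OPT}(\sigma)]$. *)

theory Defs
  imports "HOL-Probability.Probability"
begin

text \<open>
  Agents are \<open>{1..n}\<close> and items (rounds) are \<open>{1..m}\<close>. A value vector is an extensional
  function \<open>v\<close> on \<open>{1..n}\<close>, and in an input sequence \<open>\<sigma>\<close> the number \<open>\<sigma> j i\<close> is the
  value of item \<open>j\<close> for agent \<open>i\<close>. An allocation is a function \<open>a\<close> assigning to each item the
  agent receiving it.
\<close>

text \<open>The cube \<open>[0,1]\<^sup>n\<close> with its Borel sigma-algebra.\<close>

definition value_space :: "nat \<Rightarrow> (nat \<Rightarrow> real) measure" where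
  "value_space n = PiM {1..n} (\<lambda>_. restrict_space borel {0..1})"

definition value_distribution :: "nat \<Rightarrow> (nat \<Rightarrow> real) measure \<Rightarrow> bool" where
  "value_distribution n D \<longleftrightarrow> prob_space D \<and> sets D = sets (value_space n)"

definition input_distribution ::
    "nat \<Rightarrow> (nat \<Rightarrow> real) measure \<Rightarrow> (nat \<Rightarrow> nat \<Rightarrow> real) measure" where
  "input_distribution m D = PiM {1..m} (\<lambda>_. D)"

definition allocations :: "nat \<Rightarrow> nat \<Rightarrow> (nat \<Rightarrow> nat) set" where
  "allocations n m = {1..m} \<rightarrow>\<^sub>E {1..n}"

definition assigned_items :: "nat \<Rightarrow> (nat \<Rightarrow> nat) \<Rightarrow> nat \<Rightarrow> nat set" where
  "assigned_items m a i = {j \<in> {1..m}. a j = i}"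

definition valuation :: "(nat \<Rightarrow> nat \<Rightarrow> real) \<Rightarrow> nat \<Rightarrow> nat set \<Rightarrow> real" where
  "valuation \<sigma> i X = (\<Sum>j\<in>X. \<sigma> j i)"

definition min_value ::
    "nat \<Rightarrow> nat \<Rightarrow> (nat \<Rightarrow> nat \<Rightarrow> real) \<Rightarrow> (nat \<Rightarrow> nat) \<Rightarrow> real" where
  "min_value n m \<sigma> a = Min ((\<lambda>i. valuation \<sigma> i (assigned_items m a i)) ` {1..n})"

definition OPT :: "nat \<Rightarrow> nat \<Rightarrow> (nat \<Rightarrow> nat \<Rightarrow> real) \<Rightarrow> real" where
  "OPT n m \<sigma> = Max (min_value n m \<sigma> ` allocations n m)"

text \<open>
  A randomized online algorithm is given by the conditional law of its decision in each round:
  \<open>alg j \<tau> a\<close> is the distribution of the agent receiving item \<open>j\<close>, when \<open>\<tau>\<close> (a function on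
  \<open>{1..j}\<close>) is the sequence of value vectors revealed so far, including that of item \<open>j\<close>, and
  \<open>a\<close> (a function on \<open>{1..<j}\<close>) records the past decisions. Since the law may depend on all past
  decisions, this also covers algorithms whose internal randomness is shared between rounds (for
  instance a random seed drawn at the start): conditioning on the past decisions yields laws of this
  form with the same joint distribution of decisions for every input. Measurability in \<open>\<tau>\<close> makes
  the expectation over random inputs meaningful.
\<close>

type_synonym online_alg = "nat \<Rightarrow> (nat \<Rightarrow> nat \<Rightarrow> real) \<Rightarrow> (nat \<Rightarrow> nat) \<Rightarrow> nat pmf"

definition online_algorithm :: "nat \<Rightarrow> nat \<Rightarrow> online_alg \<Rightarrow> bool" where
  "online_algorithm n m alg \<longleftrightarrow>
     (\<forall>j\<in>{1..m}. \<forall>a \<in> {1..<j} \<rightarrow>\<^sub>E {1..n}.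
        (\<forall>\<tau> \<in> space (PiM {1..j} (\<lambda>_. value_space n)). set_pmf (alg j \<tau> a) \<subseteq> {1..n}) \<and>
        (\<forall>i\<in>{1..n}. (\<lambda>\<tau>. pmf (alg j \<tau> a) i)
            \<in> borel_measurable (PiM {1..j} (\<lambda>_. value_space n))))"

text \<open>The random (partial) allocation after the first \<open>j\<close> items of \<open>\<sigma>\<close>.\<close>

primrec run_alg :: "online_alg \<Rightarrow> (nat \<Rightarrow> nat \<Rightarrow> real) \<Rightarrow> nat \<Rightarrow> (nat \<Rightarrow> nat) pmf" where
  "run_alg alg \<sigma> 0 = return_pmf (\<lambda>_. undefined)"
| "run_alg alg \<sigma> (Suc j) =
     bind_pmf (run_alg alg \<sigma> j) (\<lambda>a.
     bind_pmf (alg (Suc j) (restrict \<sigma> {1..Suc j}) a) (\<lambda>i.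
     return_pmf (a(Suc j := i))))"

definition expected_ALG :: "nat \<Rightarrow> nat \<Rightarrow> (nat \<Rightarrow> real) measure \<Rightarrow> online_alg \<Rightarrow> real" where
  "expected_ALG n m D alg =
     (LINT \<sigma>|input_distribution m D.
        measure_pmf.expectation (run_alg alg \<sigma> m) (min_value n m \<sigma>))"

definition expected_OPT :: "nat \<Rightarrow> nat \<Rightarrow> (nat \<Rightarrow> real) measure \<Rightarrow> real" where
  "expected_OPT n m D = (LINT \<sigma>|input_distribution m D. OPT n m \<sigma>)"

end

theory Submission imports Defs begin

text \<open>
  Group the agents into pairs (plus one singleton if \<open>n\<close> is odd). An item has a random pair and is
  worth 1 either to both agents of that pair, or to the first only, or to the second only; there
  are \<open>m = n\<close> items, so a positive minimum forces every agent to get exactly one item, one that it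
  values. Suppose a pair receives exactly two items: offline they can be split in \<open>7\<close> of the \<open>9\<close>
  cases, while online only \<open>6\<close> of the \<open>9\<close> cases are won, since an item wanted by both agents must
  be committed before the second item is seen. Counting winning sequences with product potentials
  over the pairs shows that the ratio of the expectations is at most \<open>(6 / 7) ^ (n div 2)\<close>.
\<close>

section \<open>Independent uniform draws\<close>

text \<open>Both potential counts are inductions on the number of arrivals; this identity exposes
  the newest item.\<close>

lemma sum_PiE_Suc:
  fixes f :: "(nat \<Rightarrow> 'a) \<Rightarrow> 'b::comm_monoid_add"
  shows "(\<Sum>\<tau>\<in>{1..Suc j} \<rightarrow>\<^sub>E T. f \<tau>) = (\<Sum>\<tau>\<in>{1..j} \<rightarrow>\<^sub>E T. \<Sum>x\<in>T. f (\<tau>(Suc j := x)))"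
proof -
  have *: "{1..Suc j} = insert (Suc j) {1..j}" by auto
  have inj: "inj_on (\<lambda>(y, g). g(Suc j := y)) (T \<times> ({1..j} \<rightarrow>\<^sub>E T))"
    by (rule inj_combinator) simp
  show ?thesis
    unfolding * PiE_insert_eq sum.reindex[OF inj]
    by (subst sum.swap) (simp add: sum.cartesian_product case_prod_unfold)
qed

text \<open>Boxes determine a product measure, and on a box both sides equal the product of the
  fractions of \<open>T\<close> that \<open>g\<close> maps into the sides. Discreteness of the
  source makes every map measurable once its values lie in \<open>space M\<close>.\<close>

lemma PiM_distr_uniform:
  fixes T :: "'a set" and g :: "'a \<Rightarrow> 'b"
  assumes T: "finite T" "T \<noteq> {}" and I: "finite I" and g: "\<And>x. g x \<in> space M"
  shows "PiM I (\<lambda>_. distr (measure_pmf (pmf_of_set T)) M g) =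
         distr (measure_pmf (pmf_of_set (I \<rightarrow>\<^sub>E T))) (PiM I (\<lambda>_. M)) (\<lambda>\<tau>. \<lambda>j\<in>I. g (\<tau> j))"
proof -
  let ?D = "distr (measure_pmf (pmf_of_set T)) M g"
  let ?h = "\<lambda>\<tau>. \<lambda>j\<in>I. g (\<tau> j)"
  have gM: "g \<in> measurable (measure_pmf (pmf_of_set T)) M"
    using g by (simp add: measurable_def)
  have hM: "?h \<in> measurable (measure_pmf (pmf_of_set (I \<rightarrow>\<^sub>E T))) (PiM I (\<lambda>_. M))"
    using g by (simp add: measurable_def space_PiM)
  have fin: "finite (I \<rightarrow>\<^sub>E T)" using I T by (simp add: finite_PiE)
  have ne: "(I \<rightarrow>\<^sub>E T) \<noteq> {}" using T by (simp add: PiE_eq_empty_iff)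
  interpret product_prob_space "\<lambda>_. ?D"
    by (intro product_prob_spaceI prob_space.prob_space_distr measure_pmf.prob_space_axioms gM)
  show ?thesis
  proof (rule PiM_eqI[symmetric])
    show "finite I" by fact
    show "sets (distr (measure_pmf (pmf_of_set (I \<rightarrow>\<^sub>E T))) (PiM I (\<lambda>_. M)) ?h) = sets (PiM I (\<lambda>_. ?D))"
      by (simp cong: sets_PiM_cong)
    fix A assume "\<And>i. i \<in> I \<Longrightarrow> A i \<in> sets ?D"
    then have A: "\<And>i. i \<in> I \<Longrightarrow> A i \<in> sets M" by simp
    have "emeasure (distr (measure_pmf (pmf_of_set (I \<rightarrow>\<^sub>E T))) (PiM I (\<lambda>_. M)) ?h) (Pi\<^sub>E I A) =
        emeasure (measure_pmf (pmf_of_set (I \<rightarrow>\<^sub>E T))) (?h -` Pi\<^sub>E I A)"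
      using A I by (subst emeasure_distr[OF hM]) (auto intro!: sets_PiM_I_finite)
    also have "\<dots> = ennreal (real (card ((I \<rightarrow>\<^sub>E T) \<inter> ?h -` Pi\<^sub>E I A)) / real (card (I \<rightarrow>\<^sub>E T)))"
      by (simp add: emeasure_pmf_of_set[OF ne fin])
    also have "(I \<rightarrow>\<^sub>E T) \<inter> ?h -` Pi\<^sub>E I A = (\<Pi>\<^sub>E j\<in>I. T \<inter> g -` A j)"
      by (auto simp: PiE_iff)
    also have "real (card (\<Pi>\<^sub>E j\<in>I. T \<inter> g -` A j)) / real (card (I \<rightarrow>\<^sub>E T)) =
        (\<Prod>j\<in>I. real (card (T \<inter> g -` A j)) / real (card T))"
      using I by (simp add: card_PiE prod_dividef)
    also have "ennreal \<dots> = (\<Prod>j\<in>I. ennreal (real (card (T \<inter> g -` A j)) / real (card T)))"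
      by (simp add: prod_ennreal)
    also have "\<dots> = (\<Prod>j\<in>I. emeasure ?D (A j))"
      using A by (intro prod.cong refl) (simp add: emeasure_distr[OF gM] emeasure_pmf_of_set[OF T(2,1)])
    finally show "emeasure (distr (measure_pmf (pmf_of_set (I \<rightarrow>\<^sub>E T))) (PiM I (\<lambda>_. M)) ?h) (Pi\<^sub>E I A) =
        (\<Prod>j\<in>I. emeasure ?D (A j))" .
  qed
qed

text \<open>Reduces an expectation over i.i.d. inputs to an average over finitely many type
  sequences, so that the rest of the argument is counting.\<close>

lemma integral_PiM_distr_uniform:
  fixes T :: "'a set" and g :: "'a \<Rightarrow> 'b" and f :: "('c \<Rightarrow> 'b) \<Rightarrow> real"
  assumes T: "finite T" "T \<noteq> {}" and I: "finite I" and g: "\<And>x. g x \<in> space M"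
    and f: "f \<in> borel_measurable (PiM I (\<lambda>_. M))"
  shows "integral\<^sup>L (PiM I (\<lambda>_. distr (measure_pmf (pmf_of_set T)) M g)) f =
         (\<Sum>\<tau>\<in>I \<rightarrow>\<^sub>E T. f (\<lambda>j\<in>I. g (\<tau> j))) / real (card T) ^ card I"
proof -
  have hM: "(\<lambda>\<tau>. \<lambda>j\<in>I. g (\<tau> j)) \<in> measurable (measure_pmf (pmf_of_set (I \<rightarrow>\<^sub>E T))) (PiM I (\<lambda>_. M))"
    using g by (simp add: measurable_def space_PiM)
  have fin: "finite (I \<rightarrow>\<^sub>E T)" using I T by (simp add: finite_PiE)
  have ne: "(I \<rightarrow>\<^sub>E T) \<noteq> {}" using T by (simp add: PiE_eq_empty_iff)
  show ?thesis
    unfolding PiM_distr_uniform[OF T I g] integral_distr[OF hM f] integral_pmf_of_set[OF ne fin]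
    by (simp add: card_funcsetE[OF I])
qed

section \<open>The item types\<close>

text \<open>
  A type is a pair of a slot \<open>k\<close> and a kind: kind \<open>0\<close> is valued by both agents of the slot, kinds
  \<open>1\<close> and \<open>2\<close> by one of them. If \<open>n\<close> is odd, the last slot has the single agent \<open>n\<close>.
\<close>

definition slots :: "nat \<Rightarrow> nat set" where
  "slots n = {..<(n + 1) div 2}"

definition block :: "nat \<Rightarrow> nat \<Rightarrow> nat set" where
  "block n k = {2 * k + 1, 2 * k + 2} \<inter> {1..n}"

text \<open>A nonzero kind doubles as the offset of the interested agent inside its slot, so a lone
  agent \<open>n = 2 * k + 1\<close> needs kind \<open>1\<close>.\<close>

definition kinds :: "nat \<Rightarrow> nat \<Rightarrow> nat set" where
  "kinds n k = (if 2 * k + 2 \<le> n then {0, 1, 2} else {1})"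

definition types :: "nat \<Rightarrow> (nat \<times> nat) set" where
  "types n = Sigma (slots n) (kinds n)"

definition wanted_by :: "nat \<times> nat \<Rightarrow> nat set" where
  "wanted_by x = (if snd x = 0 then {2 * fst x + 1, 2 * fst x + 2} else {2 * fst x + snd x})"

definition item_values :: "nat \<Rightarrow> nat \<times> nat \<Rightarrow> nat \<Rightarrow> real" where
  "item_values n x = (\<lambda>i\<in>{1..n}. of_bool (i \<in> wanted_by x))"

definition pair_distribution :: "nat \<Rightarrow> (nat \<Rightarrow> real) measure" where
  "pair_distribution n = distr (measure_pmf (pmf_of_set (types n))) (value_space n) (item_values n)"

lemma finite_slots [simp]: "finite (slots n)"
  by (simp add: slots_def)

lemma finite_block [simp]: "finite (block n k)"
  by (simp add: block_def)

lemma finite_kinds [simp]: "finite (kinds n k)"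
  by (simp add: kinds_def)

lemma finite_types [simp]: "finite (types n)"
  by (simp add: types_def)

lemma types_nonempty: "n \<ge> 1 \<Longrightarrow> types n \<noteq> {}"
  unfolding types_def slots_def kinds_def by (auto simp: Sigma_empty_iff split: if_splits intro!: exI[of _ 0])

lemma block_disjoint: "k \<noteq> l \<Longrightarrow> block n k \<inter> block n l = {}"
  by (auto simp: block_def; presburger)

lemma UN_block: "(\<Union>k\<in>slots n. block n k) = {1..n}"
proof (intro equalityI subsetI)
  fix i assume i: "i \<in> {1..n}"
  have "i = 2 * ((i - 1) div 2) + 1 \<or> i = 2 * ((i - 1) div 2) + 2"
    using i by (auto; presburger)
  moreover have "(i - 1) div 2 < (n + 1) div 2"
    using i by (auto; presburger)
  ultimately show "i \<in> (\<Union>k\<in>slots n. block n k)"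
    using i unfolding slots_def block_def by blast
qed (auto simp: block_def)

text \<open>Blocks partition the agents. Hence with \<open>j\<close> agents served, the slots
  together have \<open>n - j\<close> vacancies, the growth factor of the online count.\<close>

lemma sum_card_block_diff:
  assumes "U \<subseteq> {1..n}"
  shows "(\<Sum>k\<in>slots n. card (block n k - U)) = n - card U"
proof -
  have "(\<Sum>k\<in>slots n. card (block n k - U)) = card (\<Union>k\<in>slots n. block n k - U)"
    using block_disjoint[of _ _ n] by (subst card_UN_disjoint) auto
  also have "(\<Union>k\<in>slots n. block n k - U) = {1..n} - U"
    using UN_block[of n] by blast
  finally show ?thesis
    using assms by (simp add: card_Diff_subset finite_subset)
qed

lemma slots_block: "k \<in> slots n \<Longrightarrow> block n k = (if 2 * k + 2 \<le> n then {2 * k + 1, 2 * k + 2} else {2 * k + 1})"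
  by (auto simp: slots_def block_def)

lemma wanted_by_subset_block: "x \<in> types n \<Longrightarrow> wanted_by x \<subseteq> block n (fst x)"
  by (auto simp: types_def wanted_by_def slots_def kinds_def block_def split: if_splits)

text \<open>An item changes only the factor of its own slot. If summing over its kinds scales that
  factor by \<open>r k\<close>, summing over all types scales the whole product by the sum of the
  \<open>r k\<close>, as in the product rule for derivatives. Both bounds use this.\<close>

lemma sum_types_product:
  fixes w r :: "nat \<Rightarrow> real"
  assumes "\<And>k. k \<in> slots n \<Longrightarrow> (\<Sum>t\<in>kinds n k. f k t) = r k * w k"
  shows "(\<Sum>x\<in>types n. f (fst x) (snd x) * (\<Prod>l\<in>slots n - {fst x}. w l)) =
         (\<Sum>k\<in>slots n. r k) * (\<Prod>k\<in>slots n. w k)"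
proof -
  have "(\<Sum>x\<in>types n. f (fst x) (snd x) * (\<Prod>l\<in>slots n - {fst x}. w l)) =
        (\<Sum>k\<in>slots n. (\<Sum>t\<in>kinds n k. f k t) * (\<Prod>l\<in>slots n - {k}. w l))"
    unfolding types_def by (simp add: sum.Sigma sum_distrib_right case_prod_unfold)
  also have "\<dots> = (\<Sum>k\<in>slots n. r k * (\<Prod>k\<in>slots n. w k))"
  proof (intro sum.cong refl)
    fix k assume "k \<in> slots n"
    then show "(\<Sum>t\<in>kinds n k. f k t) * (\<Prod>l\<in>slots n - {k}. w l) = r k * (\<Prod>k\<in>slots n. w k)"
      by (simp add: assms prod.remove[of _ k])
  qed
  finally show ?thesis by (simp add: sum_distrib_right)
qed

lemma prod_if_pair:
  fixes c :: real
  shows "(\<Prod>k\<in>slots n. if 2 * k + 2 \<le> n then c else 1) = c ^ (n div 2)"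
proof -
  have "(\<Prod>k\<in>slots n. if 2 * k + 2 \<le> n then c else 1) = c ^ card (slots n \<inter> {k. 2 * k + 2 \<le> n})"
    by (simp add: prod.If_cases)
  also have "slots n \<inter> {k. 2 * k + 2 \<le> n} = {..<n div 2}"
    by (auto simp: slots_def)
  finally show ?thesis by simp
qed

section \<open>Input sequences as uniform sequences of types\<close>

lemma item_values_space: "item_values n x \<in> space (value_space n)"
  by (auto simp: value_space_def space_PiM item_values_def space_restrict_space)

lemma value_distribution_pair: "value_distribution n (pair_distribution n)"
  using item_values_space unfolding value_distribution_def pair_distribution_def
  by (auto intro!: prob_space.prob_space_distr measure_pmf.prob_space_axioms simp: measurable_def)

lemma integral_pair_input:
  fixes f :: "(nat \<Rightarrow> nat \<Rightarrow> real) \<Rightarrow> real"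
  assumes "n \<ge> 1" "f \<in> borel_measurable (PiM {1..m} (\<lambda>_. value_space n))"
  shows "integral\<^sup>L (input_distribution m (pair_distribution n)) f =
         (\<Sum>\<tau>\<in>{1..m} \<rightarrow>\<^sub>E types n. f (\<lambda>j\<in>{1..m}. item_values n (\<tau> j))) / real (card (types n)) ^ m"
  using integral_PiM_distr_uniform[OF _ types_nonempty _ item_values_space assms(2)] assms(1)
  by (simp add: input_distribution_def pair_distribution_def)

lemma sets_input_distribution:
  "sets (input_distribution m (pair_distribution n)) = sets (PiM {1..m} (\<lambda>_. value_space n))"
  unfolding input_distribution_def pair_distribution_def by (simp cong: sets_PiM_cong)

section \<open>The online upper bound\<close>

text \<open>
  If \<open>U\<close> is the set of served agents and \<open>r\<close> agents of slot \<open>k\<close> are unserved, \<open>r! * weight n U k\<close> is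
  the number of sequences of \<open>r\<close> further kinds for the slot on which an optimal online player serves
  it; \<open>gain n U k t\<close> is the weight that remains after an item of kind \<open>t\<close> is used for an unserved
  agent.
\<close>

definition weight :: "nat \<Rightarrow> nat set \<Rightarrow> nat \<Rightarrow> real" where
  "weight n U k = (if 2 * k + 2 \<le> n then 1 + real (card (block n k - U)) else 1)"

definition gain :: "nat \<Rightarrow> nat set \<Rightarrow> nat \<Rightarrow> nat \<Rightarrow> real" where
  "gain n U k t = (if wanted_by (k, t) \<subseteq> U then 0 else real (card (block n k - U)))"

text \<open>With as many items as agents, one item wasted on an agent already served or not
  interested forces a final minimum of \<open>0\<close>. This predicate says that none of the first
  \<open>j\<close> items was wasted; \<open>alg_potential\<close> vanishes once one is.\<close>

definition serves :: "(nat \<Rightarrow> nat \<times> nat) \<Rightarrow> nat \<Rightarrow> (nat \<Rightarrow> nat) \<Rightarrow> bool" where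
  "serves \<tau> j a \<longleftrightarrow> inj_on a {1..j} \<and> (\<forall>i\<in>{1..j}. a i \<in> wanted_by (\<tau> i))"

definition alg_potential :: "nat \<Rightarrow> (nat \<Rightarrow> nat \<times> nat) \<Rightarrow> nat \<Rightarrow> (nat \<Rightarrow> nat) \<Rightarrow> real" where
  "alg_potential n \<tau> j a = (if serves \<tau> j a then \<Prod>k\<in>slots n. weight n (a ` {1..j}) k else 0)"

lemma weight_ge_1: "weight n U k \<ge> 1"
  by (simp add: weight_def)

lemma weight_nonneg: "weight n U k \<ge> 0"
  by (simp add: weight_def)

lemma gain_nonneg: "gain n U k t \<ge> 0"
  by (simp add: gain_def)

lemma alg_potential_nonneg: "alg_potential n \<tau> j a \<ge> 0"
  by (simp add: alg_potential_def prod_nonneg weight_nonneg)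

text \<open>With \<open>r > 0\<close> vacancies a pair has \<open>r + 1\<close> useful kinds, each
  of gain \<open>r\<close>; with \<open>r = 0\<close> both sides vanish. The slot of a lone agent
  has just one kind.\<close>

lemma sum_gain:
  assumes "k \<in> slots n"
  shows "(\<Sum>t\<in>kinds n k. gain n U k t) = real (card (block n k - U)) * weight n U k"
  by (cases "2 * k + 1 \<in> U"; cases "2 * k + 2 \<in> U")
     (auto simp: kinds_def gain_def weight_def wanted_by_def slots_block[OF assms] insert_Diff_if)

text \<open>In a pair, serving one of \<open>r\<close> unserved agents leaves weight
  \<open>1 + (r - 1) = r\<close>; a lone slot stays at \<open>1\<close>. The value is the same
  whichever interested unserved agent is chosen.\<close>

lemma weight_insert:
  assumes x: "(k, t) \<in> types n" and i: "i \<in> wanted_by (k, t)" "i \<notin> U"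
  shows "weight n (insert i U) k = gain n U k t"
proof -
  have ib: "i \<in> block n k - U" using wanted_by_subset_block[OF x] i by auto
  have k: "k \<in> slots n" using x by (simp add: types_def)
  have "block n k - insert i U = (block n k - U) - {i}" by auto
  then have c: "real (card (block n k - insert i U)) = real (card (block n k - U)) - 1"
    using card_Suc_Diff1[OF _ ib] by simp
  show ?thesis
  proof (cases "2 * k + 2 \<le> n")
    case True
    then show ?thesis using c i by (auto simp: weight_def gain_def)
  next
    case False
    then have "block n k - U = {2 * k + 1}" using ib slots_block[OF k] by auto
    then show ?thesis using False i by (auto simp: weight_def gain_def)
  qed
qed

lemma weight_insert_other:
  assumes "(k, t) \<in> types n" "i \<in> wanted_by (k, t)" "l \<noteq> k"
  shows "weight n (insert i U) l = weight n U l"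
proof -
  have "i \<notin> block n l"
    using wanted_by_subset_block[OF assms(1)] assms(2) block_disjoint[OF assms(3), of n] by auto
  then have "block n l - insert i U = block n l - U" by auto
  then show ?thesis by (simp add: weight_def)
qed

lemma serves_update:
  assumes "serves (\<tau>(Suc j := x)) (Suc j) (a(Suc j := i))"
  shows "serves \<tau> j a \<and> i \<in> wanted_by x \<and> i \<notin> a ` {1..j}"
proof -
  have inj: "inj_on (a(Suc j := i)) {1..Suc j}"
    and w: "\<And>l. l \<in> {1..Suc j} \<Longrightarrow> (a(Suc j := i)) l \<in> wanted_by ((\<tau>(Suc j := x)) l)"
    using assms by (auto simp: serves_def)
  have "inj_on (a(Suc j := i)) {1..j}" using inj by (rule inj_on_subset) auto
  moreover have "inj_on (a(Suc j := i)) {1..j} = inj_on a {1..j}" by (rule inj_on_cong) auto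
  ultimately have "inj_on a {1..j}" by simp
  moreover have "a l \<in> wanted_by (\<tau> l)" if "l \<in> {1..j}" for l using w[of l] that by auto
  moreover have "i \<in> wanted_by x" using w[of "Suc j"] by auto
  moreover have "i \<noteq> a l" if "l \<in> {1..j}" for l
    using inj_onD[OF inj, of "Suc j" l] that by auto
  ultimately show ?thesis unfolding serves_def by blast
qed

text \<open>The right-hand side does not mention \<open>i\<close>, so it bounds every decision,
  hence any random one. A useful decision attains it and a wasteful one drops the potential to
  \<open>0\<close>.\<close>

lemma alg_potential_update_le:
  assumes x: "x \<in> types n"
  shows "alg_potential n (\<tau>(Suc j := x)) (Suc j) (a(Suc j := i)) \<le>
    (if serves \<tau> j a then gain n (a ` {1..j}) (fst x) (snd x) *
       (\<Prod>l\<in>slots n - {fst x}. weight n (a ` {1..j}) l) else 0)"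
proof (cases "serves (\<tau>(Suc j := x)) (Suc j) (a(Suc j := i))")
  case True
  note * = serves_update[OF True]
  obtain k t where kt: "x = (k, t)" by (cases x)
  have k: "k \<in> slots n" using x by (simp add: types_def kt)
  have im: "(a(Suc j := i)) ` {1..Suc j} = insert i (a ` {1..j})"
    by (auto simp: image_iff atLeastAtMostSuc_conv)
  have "(\<Prod>l\<in>slots n. weight n (insert i (a ` {1..j})) l) =
      gain n (a ` {1..j}) k t * (\<Prod>l\<in>slots n - {k}. weight n (a ` {1..j}) l)"
    using * x k unfolding kt
    by (subst prod.remove[of _ k]) (auto simp: weight_insert weight_insert_other intro!: prod.cong)
  then show ?thesis using True *
    by (simp only: alg_potential_def im kt fst_conv snd_conv if_True simp_thms order_refl)
next
  case False
  have "0 \<le> gain n (a ` {1..j}) (fst x) (snd x) * (\<Prod>l\<in>slots n - {fst x}. weight n (a ` {1..j}) l)"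
    by (simp add: prod_nonneg weight_nonneg gain_nonneg)
  with False show ?thesis by (simp add: alg_potential_def)
qed

lemma serves_image:
  assumes "serves \<tau> j a" "\<tau> \<in> {1..j} \<rightarrow>\<^sub>E types n"
  shows "a ` {1..j} \<subseteq> {1..n}" "card (a ` {1..j}) = j"
proof -
  have "a l \<in> {1..n}" if "l \<in> {1..j}" for l
  proof -
    have "a l \<in> wanted_by (\<tau> l)" using assms(1) that by (simp add: serves_def)
    then show ?thesis using wanted_by_subset_block[OF PiE_mem[OF assms(2) that]] by (auto simp: block_def)
  qed
  then show "a ` {1..j} \<subseteq> {1..n}" by blast
  show "card (a ` {1..j}) = j" using assms(1) by (simp add: serves_def card_image)
qed

text \<open>One-step growth: \<open>sum_types_product\<close> with the vacancies of a slot as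
  \<open>r k\<close>, which add up to \<open>n - j\<close>.\<close>

lemma sum_gain_weight:
  assumes "\<tau> \<in> {1..j} \<rightarrow>\<^sub>E types n"
  shows "(\<Sum>x\<in>types n. if serves \<tau> j a then gain n (a ` {1..j}) (fst x) (snd x) *
       (\<Prod>l\<in>slots n - {fst x}. weight n (a ` {1..j}) l) else 0) = real (n - j) * alg_potential n \<tau> j a"
proof (cases "serves \<tau> j a")
  case True
  have "(\<Sum>k\<in>slots n. real (card (block n k - a ` {1..j}))) = real (n - j)"
    using sum_card_block_diff[of "a ` {1..j}" n] serves_image[OF True assms]
    by (simp flip: of_nat_sum)
  then show ?thesis
    using True sum_types_product[OF sum_gain, of n "\<lambda>_. a ` {1..j}"]
    by (simp add: alg_potential_def)
qed (simp add: alg_potential_def)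

text \<open>This is where being online enters: the law of the first \<open>j\<close> decisions
  cannot depend on items still to come.\<close>

lemma run_alg_cong:
  "(\<And>i. i \<in> {1..j} \<Longrightarrow> \<sigma> i = \<sigma>' i) \<Longrightarrow> run_alg alg \<sigma> j = run_alg alg \<sigma>' j"
proof (induction j)
  case (Suc j)
  have "run_alg alg \<sigma> j = run_alg alg \<sigma>' j" using Suc.prems by (intro Suc.IH) auto
  moreover have "restrict \<sigma> {1..Suc j} = restrict \<sigma>' {1..Suc j}" using Suc.prems by (auto simp: restrict_def)
  ultimately show ?case by simp
qed simp

text \<open>Each arrival multiplies the total potential by at most the number of vacancies, which
  builds the falling factorial \<open>fact n / fact (n - j)\<close>. Nonnegative integrals avoid
  integrability questions about the law of \<open>a\<close>.\<close>

lemma sum_alg_potential_le: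
  assumes "j \<le> n"
  shows "(\<Sum>\<tau>\<in>{1..j} \<rightarrow>\<^sub>E types n. \<integral>\<^sup>+a. ennreal (alg_potential n \<tau> j a)
            \<partial>run_alg alg (\<lambda>l. item_values n (\<tau> l)) j)
         \<le> ennreal (fact n / fact (n - j) * 3 ^ (n div 2))"
  using assms
proof (induction j)
  case 0
  \<comment> \<open>No agent is served yet, so each pair has weight
    \<open>1 + 2 = 3\<close>.\<close>
  have "(\<Prod>k\<in>slots n. weight n {} k) = (\<Prod>k\<in>slots n. if 2 * k + 2 \<le> n then 3 else 1)"
    by (intro prod.cong refl) (auto simp: weight_def slots_block)
  also have "\<dots> = 3 ^ (n div 2)" by (rule prod_if_pair)
  finally show ?case by (simp add: alg_potential_def serves_def)
next
  case (Suc j)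
  let ?T = "types n"
  let ?\<sigma> = "\<lambda>\<tau> l. item_values n (\<tau> l)"
  let ?G = "\<lambda>\<tau> a x. if serves \<tau> j a then gain n (a ` {1..j}) (fst x) (snd x) *
       (\<Prod>l\<in>slots n - {fst x}. weight n (a ` {1..j}) l) else 0"
  have step: "(\<Sum>x\<in>?T. \<integral>\<^sup>+a. ennreal (alg_potential n (\<tau>(Suc j := x)) (Suc j) a)
                 \<partial>run_alg alg (?\<sigma> (\<tau>(Suc j := x))) (Suc j))
      \<le> ennreal (real (n - j)) * (\<integral>\<^sup>+a. ennreal (alg_potential n \<tau> j a) \<partial>run_alg alg (?\<sigma> \<tau>) j)"
    if \<tau>: "\<tau> \<in> {1..j} \<rightarrow>\<^sub>E ?T" for \<tau>
  proof -
    have "(\<Sum>x\<in>?T. \<integral>\<^sup>+a. ennreal (alg_potential n (\<tau>(Suc j := x)) (Suc j) a)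
                 \<partial>run_alg alg (?\<sigma> (\<tau>(Suc j := x))) (Suc j))
        \<le> (\<Sum>x\<in>?T. \<integral>\<^sup>+a. ennreal (?G \<tau> a x) \<partial>run_alg alg (?\<sigma> \<tau>) j)"
    proof (rule sum_mono)
      fix x assume x: "x \<in> ?T"
      \<comment> \<open>The type \<open>x\<close> is revealed only after these \<open>j\<close>
        decisions, so their law is common to all \<open>x\<close> and the sum over \<open>x\<close>
        can move inside the integral.\<close>
      have eq: "run_alg alg (?\<sigma> (\<tau>(Suc j := x))) j = run_alg alg (?\<sigma> \<tau>) j"
        by (rule run_alg_cong) auto
      have "(\<integral>\<^sup>+i. ennreal (alg_potential n (\<tau>(Suc j := x)) (Suc j) (a(Suc j := i))) \<partial>measure_pmf p)
           \<le> ennreal (?G \<tau> a x)" for a p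
      proof -
        have "(\<integral>\<^sup>+i. ennreal (alg_potential n (\<tau>(Suc j := x)) (Suc j) (a(Suc j := i))) \<partial>measure_pmf p)
           \<le> (\<integral>\<^sup>+i. ennreal (?G \<tau> a x) \<partial>measure_pmf p)"
          using alg_potential_update_le[OF x] by (intro nn_integral_mono ennreal_leI) 
        then show ?thesis by simp
      qed
      then show "(\<integral>\<^sup>+a. ennreal (alg_potential n (\<tau>(Suc j := x)) (Suc j) a)
                 \<partial>run_alg alg (?\<sigma> (\<tau>(Suc j := x))) (Suc j))
        \<le> (\<integral>\<^sup>+a. ennreal (?G \<tau> a x) \<partial>run_alg alg (?\<sigma> \<tau>) j)"
        by (simp only: run_alg.simps eq nn_integral_bind_pmf nn_integral_return_pmf zero_le) (intro nn_integral_mono)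
    qed
    also have "\<dots> = (\<integral>\<^sup>+a. (\<Sum>x\<in>?T. ennreal (?G \<tau> a x)) \<partial>run_alg alg (?\<sigma> \<tau>) j)"
      by (simp add: nn_integral_sum)
    also have "\<dots> = (\<integral>\<^sup>+a. ennreal (real (n - j)) * ennreal (alg_potential n \<tau> j a) \<partial>run_alg alg (?\<sigma> \<tau>) j)"
    proof (rule nn_integral_cong)
      fix a
      have "?G \<tau> a x \<ge> 0" for x
        by (simp add: prod_nonneg weight_nonneg gain_nonneg)
      then have "(\<Sum>x\<in>?T. ennreal (?G \<tau> a x)) = ennreal (\<Sum>x\<in>?T. ?G \<tau> a x)"
        by (intro sum_ennreal)
      then show "(\<Sum>x\<in>?T. ennreal (?G \<tau> a x)) = ennreal (real (n - j)) * ennreal (alg_potential n \<tau> j a)"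
        unfolding sum_gain_weight[OF \<tau>] by (simp add: ennreal_mult alg_potential_nonneg)
    qed
    also have "\<dots> = ennreal (real (n - j)) * (\<integral>\<^sup>+a. ennreal (alg_potential n \<tau> j a) \<partial>run_alg alg (?\<sigma> \<tau>) j)"
      by (simp add: nn_integral_cmult)
    finally show ?thesis .
  qed
  have "(\<Sum>\<tau>\<in>{1..Suc j} \<rightarrow>\<^sub>E ?T. \<integral>\<^sup>+a. ennreal (alg_potential n \<tau> (Suc j) a) \<partial>run_alg alg (?\<sigma> \<tau>) (Suc j))
     \<le> (\<Sum>\<tau>\<in>{1..j} \<rightarrow>\<^sub>E ?T. ennreal (real (n - j)) * (\<integral>\<^sup>+a. ennreal (alg_potential n \<tau> j a) \<partial>run_alg alg (?\<sigma> \<tau>) j))"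
    unfolding sum_PiE_Suc by (intro sum_mono step)
  also have "\<dots> \<le> ennreal (real (n - j)) * ennreal (fact n / fact (n - j) * 3 ^ (n div 2))"
    using Suc unfolding sum_distrib_left[symmetric] by (intro mult_left_mono) auto
  also have "\<dots> = ennreal (real (n - j) * (fact n / fact (n - j) * 3 ^ (n div 2)))"
    by (rule ennreal_mult[symmetric]) simp_all
  also have "real (n - j) * (fact n / fact (n - j) * 3 ^ (n div 2)) = fact n / fact (n - Suc j) * 3 ^ (n div 2)"
  proof -
    have "n - j = Suc (n - Suc j)" using Suc.prems by simp
    then have "(fact (n - j) :: real) = real (n - j) * fact (n - Suc j)" by (metis fact_Suc)
    then show ?thesis using Suc.prems by simp
  qed
  finally show ?case .
qed

section \<open>From potentials to the expected value of the algorithm\<close>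

lemma min_value_le:
  assumes "i \<in> {1..n}"
  shows "min_value n m \<sigma> a \<le> valuation \<sigma> i (assigned_items m a i)"
  unfolding min_value_def using assms by (intro Min_le) auto

lemma valuation_item_values:
  assumes "i \<in> {1..n}" "finite X"
  shows "valuation (\<lambda>l. item_values n (\<tau> l)) i X = real (card {l \<in> X. i \<in> wanted_by (\<tau> l)})"
  using assms by (simp add: valuation_def item_values_def Int_def)

text \<open>If no item is wasted, agent \<open>1\<close> holds at most one item it values, so the
  minimum is at most \<open>1\<close>, while the potential is a product of weights that are each at
  least \<open>1\<close>. Otherwise some agent holds nothing it values, and the minimum is at most
  \<open>0\<close>.\<close>

lemma min_value_le_alg_potential:
  assumes n: "n \<ge> 1" and \<tau>: "\<tau> \<in> {1..n} \<rightarrow>\<^sub>E types n"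
  shows "min_value n n (\<lambda>l. item_values n (\<tau> l)) a \<le> alg_potential n \<tau> n a"
proof -
  let ?X = "\<lambda>i. {l \<in> assigned_items n a i. i \<in> wanted_by (\<tau> l)}"
  have le: "min_value n n (\<lambda>l. item_values n (\<tau> l)) a \<le> real (card (?X i))" if "i \<in> {1..n}" for i
    using min_value_le[OF that, of n "\<lambda>l. item_values n (\<tau> l)" a]
    by (simp add: valuation_item_values[OF that] assigned_items_def)
  show ?thesis
  proof (cases "serves \<tau> n a")
    case True
    have "l = l'" if "l \<in> ?X 1" "l' \<in> ?X 1" for l l'
      using True that inj_onD[of a "{1..n}" l l'] by (simp add: serves_def assigned_items_def)
    moreover have "finite (?X 1)" by (simp add: assigned_items_def)
    ultimately have "card (?X 1) \<le> 1"
      unfolding One_nat_def by (subst card_le_Suc0_iff_eq) auto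
    then have "min_value n n (\<lambda>l. item_values n (\<tau> l)) a \<le> 1"
      using le[of 1] n by (auto intro: order_trans)
    also have "1 \<le> alg_potential n \<tau> n a"
      using True weight_ge_1 by (simp add: alg_potential_def prod_ge_1)
    finally show ?thesis .
  next
    case False
    have "\<exists>i\<in>{1..n}. ?X i = {}"
    proof (rule ccontr)
      assume "\<not> ?thesis"
      then have "\<forall>i\<in>{1..n}. \<exists>l. l \<in> ?X i" by blast
      then obtain g where "\<forall>i\<in>{1..n}. g i \<in> ?X i" by (rule bchoice[THEN exE])
      then have g: "g i \<in> {1..n}" "a (g i) = i" "i \<in> wanted_by (\<tau> (g i))" if "i \<in> {1..n}" for i
        using that by (auto simp: assigned_items_def)
      \<comment> \<open>\<open>a\<close> is a left inverse of \<open>g\<close>, so \<open>g\<close>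
        is injective; with equally many items and agents it is a bijection, and no item was
        wasted.\<close>
      have inj: "inj_on g {1..n}" by (rule inj_on_inverseI[of _ a]) (rule g(2))
      have im: "g ` {1..n} = {1..n}" using g(1) by (intro endo_inj_surj inj) auto
      have "inj_on a (g ` {1..n})" by (rule inj_on_inverseI[of _ g]) (auto simp: g(2))
      moreover have "a l \<in> wanted_by (\<tau> l)" if l: "l \<in> g ` {1..n}" for l
        using l g(2,3) by auto
      ultimately have "serves \<tau> n a" unfolding serves_def im by blast
      with False show False by simp
    qed
    then obtain i where i: "i \<in> {1..n}" and empty: "?X i = {}" by blast
    show ?thesis using le[OF i] False unfolding empty by (simp add: alg_potential_def)
  qed
qed

lemma sum_expectation_min_value_le:
  assumes n: "n \<ge> 1"
  shows "(\<Sum>\<tau>\<in>{1..n} \<rightarrow>\<^sub>E types n. measure_pmf.expectation (run_alg alg (\<lambda>l. item_values n (\<tau> l)) n)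
            (min_value n n (\<lambda>l. item_values n (\<tau> l)))) \<le> fact n * 3 ^ (n div 2)"
proof -
  let ?\<sigma> = "\<lambda>\<tau> l. item_values n (\<tau> l)"
  let ?S = "{1..n} \<rightarrow>\<^sub>E types n"
  let ?I = "\<lambda>\<tau>. \<integral>\<^sup>+a. ennreal (alg_potential n \<tau> n a) \<partial>run_alg alg (?\<sigma> \<tau>) n"
  have fin: "finite ?S" by (simp add: finite_PiE)
  have le: "(\<Sum>\<tau>\<in>?S. ?I \<tau>) \<le> ennreal (fact n * 3 ^ (n div 2))"
    using sum_alg_potential_le[of n n alg] by simp
  then have "(\<Sum>\<tau>\<in>?S. ?I \<tau>) < top" by (rule le_less_trans) simp
  then have top: "\<And>\<tau>. \<tau> \<in> ?S \<Longrightarrow> ?I \<tau> < top" using fin by simp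
  have "(\<Sum>\<tau>\<in>?S. measure_pmf.expectation (run_alg alg (?\<sigma> \<tau>) n) (min_value n n (?\<sigma> \<tau>)))
      \<le> (\<Sum>\<tau>\<in>?S. enn2real (?I \<tau>))"
  \<comment> \<open>A bound on the nonnegative integral also bounds the Bochner integral, whose
    default is \<open>0\<close> for a function that is not integrable.\<close>
  proof (intro sum_mono integral_real_bounded)
    fix \<tau> assume \<tau>: "\<tau> \<in> ?S"
    have "(\<integral>\<^sup>+a. ennreal (min_value n n (?\<sigma> \<tau>) a) \<partial>run_alg alg (?\<sigma> \<tau>) n) \<le> ?I \<tau>"
      by (intro nn_integral_mono ennreal_leI min_value_le_alg_potential n \<tau>)
    then show "(\<integral>\<^sup>+a. ennreal (min_value n n (?\<sigma> \<tau>) a) \<partial>run_alg alg (?\<sigma> \<tau>) n) \<le> ennreal (enn2real (?I \<tau>))"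
      using top[OF \<tau>] by simp
  qed simp
  also have "\<dots> \<le> fact n * 3 ^ (n div 2)"
  proof -
    have "ennreal (\<Sum>\<tau>\<in>?S. enn2real (?I \<tau>)) = (\<Sum>\<tau>\<in>?S. ?I \<tau>)"
      using top by (simp add: sum_ennreal[symmetric])
    then have "ennreal (\<Sum>\<tau>\<in>?S. enn2real (?I \<tau>)) \<le> ennreal (fact n * 3 ^ (n div 2))" using le by simp
    then show ?thesis by (subst (asm) ennreal_le_iff) auto
  qed
  finally show ?thesis .
qed

lemma min_value_cong:
  assumes "\<And>l. l \<in> {1..m} \<Longrightarrow> \<sigma> l = \<sigma>' l"
  shows "min_value n m \<sigma> a = min_value n m \<sigma>' a"
proof -
  have "valuation \<sigma> i (assigned_items m a i) = valuation \<sigma>' i (assigned_items m a i)" for i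
    unfolding valuation_def assigned_items_def using assms by (intro sum.cong) auto
  then show ?thesis by (simp add: min_value_def)
qed

lemma expected_ALG_le:
  assumes n: "n \<ge> 1"
  shows "expected_ALG n n (pair_distribution n) alg \<le> fact n * 3 ^ (n div 2) / real (card (types n)) ^ n"
proof -
  let ?f = "\<lambda>\<sigma>. measure_pmf.expectation (run_alg alg \<sigma> n) (min_value n n \<sigma>)"
  \<comment> \<open>The integral is \<open>0\<close> if \<open>?f\<close> is not integrable, so its measurability need not be shown.\<close>
  show ?thesis
  proof (cases "integrable (input_distribution n (pair_distribution n)) ?f")
    case True
    then have "?f \<in> borel_measurable (input_distribution n (pair_distribution n))"
      by (rule borel_measurable_integrable)
    then have "?f \<in> borel_measurable (PiM {1..n} (\<lambda>_. value_space n))"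
      by (simp cong: measurable_cong_sets add: measurable_cong_sets[OF sets_input_distribution refl])
    note integral_pair_input[OF n this]
    \<comment> \<open>The product measure yields functions that are \<open>undefined\<close> outside
      \<open>{1..n}\<close>; neither the run nor the minimum looks there.\<close>
    moreover have "?f (\<lambda>l\<in>{1..n}. item_values n (\<tau> l)) = ?f (\<lambda>l. item_values n (\<tau> l))" for \<tau>
    proof -
      let ?\<sigma> = "\<lambda>l\<in>{1..n}. item_values n (\<tau> l)" and ?\<sigma>' = "\<lambda>l. item_values n (\<tau> l)"
      have "run_alg alg ?\<sigma> n = run_alg alg ?\<sigma>' n" by (rule run_alg_cong) simp
      moreover have "min_value n n ?\<sigma> = min_value n n ?\<sigma>'" by (intro ext min_value_cong) simp
      ultimately show ?thesis by (simp only:)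
    qed
    ultimately show ?thesis
      using sum_expectation_min_value_le[OF n, of alg]
      by (simp add: expected_ALG_def divide_right_mono)
  next
    case False
    then show ?thesis by (simp add: expected_ALG_def not_integrable_integral_eq)
  qed
qed

section \<open>The offline lower bound\<close>

text \<open>
  If \<open>r\<close> more items are needed to fill slot \<open>k\<close>, whose items so far have the kinds \<open>ts\<close>, then
  \<open>completions n k ts\<close> is \<open>1 / r!\<close> times the number of sequences of \<open>r\<close> further kinds after which
  each agent of the slot can be given a valued item.
\<close>

fun completions :: "nat \<Rightarrow> nat \<Rightarrow> nat list \<Rightarrow> real" where
  "completions n k [] = (if 2 * k + 2 \<le> n then 7 / 2 else 1)"
| "completions n k [t] = (if 2 * k + 2 \<le> n then (if t = 0 then 3 else 2) else 1)"
| "completions n k [s, t] = of_bool (2 * k + 2 \<le> n \<and> (s \<noteq> t \<or> s = 0))"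
| "completions n k (_ # _ # _ # _) = 0"

text \<open>Lists rather than sets, so that an arrival appends one entry and
  \<open>completions\<close> can match on the length.\<close>

definition slot_items :: "(nat \<Rightarrow> nat \<times> nat) \<Rightarrow> nat \<Rightarrow> nat \<Rightarrow> nat list" where
  "slot_items \<tau> j k = filter (\<lambda>l. fst (\<tau> l) = k) [1..<Suc j]"

definition slot_kinds :: "(nat \<Rightarrow> nat \<times> nat) \<Rightarrow> nat \<Rightarrow> nat \<Rightarrow> nat list" where
  "slot_kinds \<tau> j k = map (\<lambda>l. snd (\<tau> l)) (slot_items \<tau> j k)"

definition opt_potential :: "nat \<Rightarrow> (nat \<Rightarrow> nat \<times> nat) \<Rightarrow> nat \<Rightarrow> real" where
  "opt_potential n \<tau> j = (\<Prod>k\<in>slots n. completions n k (slot_kinds \<tau> j k))"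

text \<open>For an empty pair the new values are \<open>3 + 2 + 2 = 2 * (7 / 2)\<close>. An overfull
  slot makes the factor negative, harmlessly, since \<open>completions\<close> is \<open>0\<close>
  there.\<close>

lemma sum_completions:
  assumes k: "k \<in> slots n" and ts: "set ts \<subseteq> kinds n k"
  shows "(\<Sum>t\<in>kinds n k. completions n k (ts @ [t])) =
         (real (card (block n k)) - real (length ts)) * completions n k ts"
proof -
  consider "ts = []" | s where "ts = [s]" | s t where "ts = [s, t]"
    | s t u us where "ts = s # t # u # us"
    by (metis list.exhaust)
  then show ?thesis
    using ts by cases (auto simp: kinds_def slots_block[OF k])
qed

lemma slot_kinds_Suc:
  "slot_kinds (\<tau>(Suc j := x)) (Suc j) k = slot_kinds \<tau> j k @ (if fst x = k then [snd x] else [])"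
proof -
  have "filter (\<lambda>l. fst ((\<tau>(Suc j := x)) l) = k) [1..<Suc j] = filter (\<lambda>l. fst (\<tau> l) = k) [1..<Suc j]"
    by (rule filter_cong) auto
  then show ?thesis by (auto simp: slot_kinds_def slot_items_def)
qed

lemma set_slot_kinds:
  assumes "\<tau> \<in> {1..j} \<rightarrow>\<^sub>E types n"
  shows "set (slot_kinds \<tau> j k) \<subseteq> kinds n k"
proof -
  have "snd (\<tau> l) \<in> kinds n (fst (\<tau> l))" if "l \<in> {1..j}" for l
    using PiE_mem[OF assms that] by (auto simp: types_def)
  then show ?thesis by (auto simp: slot_kinds_def slot_items_def)
qed

lemma length_slot_kinds: "length (slot_kinds \<tau> j k) = card {l \<in> {1..j}. fst (\<tau> l) = k}"
proof -
  have "length (slot_kinds \<tau> j k) = card (set (slot_items \<tau> j k))"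
    unfolding slot_kinds_def slot_items_def length_map by (rule distinct_card[symmetric]) simp
  also have "set (slot_items \<tau> j k) = {l \<in> {1..j}. fst (\<tau> l) = k}"
    by (auto simp: slot_items_def)
  finally show ?thesis .
qed

lemma sum_length_slot_kinds:
  assumes "\<tau> \<in> {1..j} \<rightarrow>\<^sub>E types n"
  shows "(\<Sum>k\<in>slots n. length (slot_kinds \<tau> j k)) = j"
proof -
  have "fst (\<tau> l) \<in> slots n" if "l \<in> {1..j}" for l
    using PiE_mem[OF assms that] by (auto simp: types_def)
  then have cover: "(\<Union>k\<in>slots n. {l \<in> {1..j}. fst (\<tau> l) = k}) = {1..j}" by auto
  have "(\<Sum>k\<in>slots n. length (slot_kinds \<tau> j k)) = card (\<Union>k\<in>slots n. {l \<in> {1..j}. fst (\<tau> l) = k})"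
    unfolding length_slot_kinds by (intro card_UN_disjoint[symmetric]) auto
  then show ?thesis unfolding cover by simp
qed

text \<open>The subtraction is real because truncation at overfull slots would spoil the
  total.\<close>

lemma sum_block_minus_length:
  assumes "\<tau> \<in> {1..j} \<rightarrow>\<^sub>E types n"
  shows "(\<Sum>k\<in>slots n. real (card (block n k)) - real (length (slot_kinds \<tau> j k))) = real n - real j"
  using sum_length_slot_kinds[OF assms] sum_card_block_diff[of "{}" n]
  by (simp add: sum_subtractf flip: of_nat_sum)

text \<open>The same recurrence as online, but exact, as no decision intervenes. Only the initial
  factor of a pair differs, \<open>7 / 2\<close> instead of \<open>3\<close>, which is the source of
  the gap.\<close>

lemma sum_opt_potential:
  assumes "j \<le> n"
  shows "(\<Sum>\<tau>\<in>{1..j} \<rightarrow>\<^sub>E types n. opt_potential n \<tau> j) = fact n / fact (n - j) * (7 / 2) ^ (n div 2)"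
  using assms
proof (induction j)
  case 0
  show ?case using prod_if_pair[of n "7 / 2"]
    by (simp add: opt_potential_def slot_kinds_def slot_items_def)
next
  case (Suc j)
  have step: "(\<Sum>x\<in>types n. opt_potential n (\<tau>(Suc j := x)) (Suc j)) = (real n - real j) * opt_potential n \<tau> j"
    if \<tau>: "\<tau> \<in> {1..j} \<rightarrow>\<^sub>E types n" for \<tau>
  proof -
    let ?w = "\<lambda>k. completions n k (slot_kinds \<tau> j k)"
    have "(\<Sum>x\<in>types n. opt_potential n (\<tau>(Suc j := x)) (Suc j)) =
      (\<Sum>x\<in>types n. completions n (fst x) (slot_kinds \<tau> j (fst x) @ [snd x]) * (\<Prod>l\<in>slots n - {fst x}. ?w l))"
    proof (intro sum.cong refl)
      fix x assume "x \<in> types n"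
      then have "fst x \<in> slots n" by (auto simp: types_def)
      then show "opt_potential n (\<tau>(Suc j := x)) (Suc j) =
          completions n (fst x) (slot_kinds \<tau> j (fst x) @ [snd x]) * (\<Prod>l\<in>slots n - {fst x}. ?w l)"
        unfolding opt_potential_def slot_kinds_Suc
        by (subst prod.remove[of _ "fst x"]) (auto intro!: prod.cong)
    qed
    also have "\<dots> = (real n - real j) * opt_potential n \<tau> j"
      using sum_types_product[OF sum_completions[OF _ set_slot_kinds[OF \<tau>]]]
        sum_block_minus_length[OF \<tau>]
      by (simp add: opt_potential_def)
    finally show ?thesis .
  qed
  have "n - j = Suc (n - Suc j)" using Suc.prems by simp
  then have f: "(fact (n - j) :: real) = (real n - real j) * fact (n - Suc j)"
    using Suc.prems by (metis Suc_leD fact_Suc of_nat_diff)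
  have "(\<Sum>\<tau>\<in>{1..Suc j} \<rightarrow>\<^sub>E types n. opt_potential n \<tau> (Suc j)) =
      (real n - real j) * (fact n / fact (n - j) * (7 / 2) ^ (n div 2))"
    unfolding sum_PiE_Suc using Suc by (simp add: step sum_distrib_left[symmetric])
  also have "\<dots> = fact n / fact (n - Suc j) * (7 / 2) ^ (n div 2)"
    using Suc.prems unfolding f by simp
  finally show ?case .
qed

section \<open>From the offline potential to an allocation\<close>

lemma completions_0_or_1:
  assumes "k \<in> slots n" "length ts = card (block n k)"
  shows "completions n k ts \<in> {0, 1}"
  using assms(2) unfolding slots_block[OF assms(1)]
  by (auto split: if_splits simp: length_Suc_conv eval_nat_numeral)

lemma completions_nonzero_length: "k \<in> slots n \<Longrightarrow> completions n k ts \<noteq> 0 \<Longrightarrow> length ts \<le> card (block n k)"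
  by (induction n k ts rule: completions.induct) (auto simp: slots_block split: if_splits)

text \<open>Two items of one pair fail only when both are wanted by the same single agent; otherwise
  the straight or the crossed assignment works.\<close>

lemma slot_items_cover:
  assumes k: "k \<in> slots n"
    and len: "length (slot_kinds \<tau> n k) = card (block n k)" and nz: "completions n k (slot_kinds \<tau> n k) \<noteq> 0"
    and \<tau>: "\<tau> \<in> {1..n} \<rightarrow>\<^sub>E types n"
  shows "\<exists>g. inj_on g (block n k) \<and> (\<forall>i\<in>block n k. g i \<in> {1..n} \<and> fst (\<tau> (g i)) = k \<and> i \<in> wanted_by (\<tau> (g i)))"
proof -
  have mem: "l \<in> {1..n} \<and> fst (\<tau> l) = k" if "l \<in> set (slot_items \<tau> n k)" for l
    using that by (auto simp: slot_items_def)
  have kind: "snd (\<tau> l) \<in> kinds n k" if "l \<in> set (slot_items \<tau> n k)" for l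
    using set_slot_kinds[OF \<tau>, of k] that by (auto simp: slot_kinds_def)
  have dist: "distinct (slot_items \<tau> n k)" by (simp add: slot_items_def)
  have len': "length (slot_items \<tau> n k) = card (block n k)" using len by (simp add: slot_kinds_def)
  show ?thesis
  proof (cases "2 * k + 2 \<le> n")
    case True
    have b: "block n k = {2 * k + 1, 2 * k + 2}" using slots_block[OF k] True by simp
    have "length (slot_items \<tau> n k) = Suc (Suc 0)" using len' by (simp add: b)
    then obtain x y where xy: "slot_items \<tau> n k = [x, y]" by (auto simp: length_Suc_conv)
    have ne: "x \<noteq> y" using dist xy by simp
    have m: "x \<in> {1..n}" "y \<in> {1..n}" "fst (\<tau> x) = k" "fst (\<tau> y) = k" using mem[of x] mem[of y] xy by auto
    have kd: "snd (\<tau> x) \<in> {0, 1, 2}" "snd (\<tau> y) \<in> {0, 1, 2}"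
      using kind[of x] kind[of y] xy True by (auto simp: kinds_def)
    have c: "snd (\<tau> x) \<noteq> snd (\<tau> y) \<or> snd (\<tau> x) = 0" using nz by (simp add: slot_kinds_def xy)
    \<comment> \<open>Straight if that suits both agents, crossed otherwise; a first item of kind
      \<open>2\<close> or a second one of kind \<open>1\<close> forces the crossing.\<close>
    define g where "g = (if 2 * k + 1 \<in> wanted_by (\<tau> x) \<and> 2 * k + 2 \<in> wanted_by (\<tau> y)
      then (\<lambda>i. if i = 2 * k + 1 then x else y) else (\<lambda>i. if i = 2 * k + 1 then y else x))"
    have "inj_on g (block n k)" using ne by (auto simp: b g_def)
    moreover have "\<forall>i\<in>block n k. g i \<in> {1..n} \<and> fst (\<tau> (g i)) = k \<and> i \<in> wanted_by (\<tau> (g i))"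
      using m kd c by (auto simp: b g_def wanted_by_def)
    ultimately show ?thesis by blast
  next
    case False
    have b: "block n k = {2 * k + 1}" using slots_block[OF k] False by simp
    have "length (slot_items \<tau> n k) = Suc 0" using len' by (simp add: b)
    then obtain x where x: "slot_items \<tau> n k = [x]" by (auto simp: length_Suc_conv)
    have "x \<in> {1..n}" "fst (\<tau> x) = k" "snd (\<tau> x) = 1"
      using mem[of x] kind[of x] x False by (auto simp: kinds_def)
    then show ?thesis by (intro exI[of _ "\<lambda>_. x"]) (auto simp: b wanted_by_def)
  qed
qed

lemma min_value_le_OPT: "a \<in> allocations n m \<Longrightarrow> min_value n m \<sigma> a \<le> OPT n m \<sigma>"
  unfolding OPT_def allocations_def by (intro Max_ge) (auto simp: finite_PiE)

text \<open>After \<open>n\<close> arrivals a nonzero potential means that no slot is overfull, so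
  by counting all are exactly full and the potential is \<open>1\<close>. The matchings of the slots
  then combine to an allocation of minimum at least \<open>1\<close>.\<close>

lemma opt_potential_le_OPT:
  assumes n: "n \<ge> 1" and \<tau>: "\<tau> \<in> {1..n} \<rightarrow>\<^sub>E types n"
  shows "opt_potential n \<tau> n \<le> OPT n n (\<lambda>l. item_values n (\<tau> l))"
proof (cases "opt_potential n \<tau> n = 0")
  case True
  \<comment> \<open>Any allocation shows that \<open>OPT\<close> is nonnegative.\<close>
  let ?a = "\<lambda>l\<in>{1..n}. 1 :: nat"
  have "0 \<le> min_value n n (\<lambda>l. item_values n (\<tau> l)) ?a"
    unfolding min_value_def using n
    by (subst Min_ge_iff) (auto simp: valuation_item_values assigned_items_def)
  also have "\<dots> \<le> OPT n n (\<lambda>l. item_values n (\<tau> l))"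
    using n by (intro min_value_le_OPT) (auto simp: allocations_def)
  finally show ?thesis using True by simp
next
  case False
  then have nz: "\<And>k. k \<in> slots n \<Longrightarrow> completions n k (slot_kinds \<tau> n k) \<noteq> 0"
    by (auto simp: opt_potential_def)
  have "(\<Sum>k\<in>slots n. real (card (block n k)) - real (length (slot_kinds \<tau> n k))) = 0"
    using sum_block_minus_length[OF \<tau>] by simp
  then have len: "\<And>k. k \<in> slots n \<Longrightarrow> length (slot_kinds \<tau> n k) = card (block n k)"
    by (subst (asm) sum_nonneg_eq_0_iff) (auto dest: completions_nonzero_length[OF _ nz])
  have "opt_potential n \<tau> n = 1"
    unfolding opt_potential_def using completions_0_or_1[OF _ len] nz by (intro prod.neutral) blast
  have "\<forall>k\<in>slots n. \<exists>g. inj_on g (block n k) \<and> (\<forall>i\<in>block n k. g i \<in> {1..n} \<and> fst (\<tau> (g i)) = k \<and> i \<in> wanted_by (\<tau> (g i)))"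
    using slot_items_cover[OF _ len nz \<tau>] by blast
  then obtain G where G: "\<And>k. k \<in> slots n \<Longrightarrow> inj_on (G k) (block n k)"
    "\<And>k i. k \<in> slots n \<Longrightarrow> i \<in> block n k \<Longrightarrow> G k i \<in> {1..n} \<and> fst (\<tau> (G k i)) = k \<and> i \<in> wanted_by (\<tau> (G k i))"
    by metis
  have "\<forall>i\<in>{1..n}. \<exists>k\<in>slots n. i \<in> block n k" using UN_block[of n] by blast
  then obtain s where s: "\<And>i. i \<in> {1..n} \<Longrightarrow> s i \<in> slots n \<and> i \<in> block n (s i)" by metis
  define g where "g i = G (s i) i" for i
  have g: "g i \<in> {1..n} \<and> fst (\<tau> (g i)) = s i \<and> i \<in> wanted_by (\<tau> (g i))" if "i \<in> {1..n}" for i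
    unfolding g_def using s[OF that] G(2) by blast
  have inj: "inj_on g {1..n}"
  proof (rule inj_onI)
    fix i i' assume i: "i \<in> {1..n}" "i' \<in> {1..n}" "g i = g i'"
    \<comment> \<open>Equal items have equal slots, which reduces injectivity to a single
      block.\<close>
    then have "s i = s i'" using g by metis
    then show "i = i'" using i s[of i] s[of i'] G(1) by (auto simp: g_def dest: inj_onD)
  qed
  \<comment> \<open>The fallback agent \<open>1\<close> makes \<open>a\<close> an allocation without
    showing first that \<open>g\<close> is onto.\<close>
  define a where "a = (\<lambda>l\<in>{1..n}. if l \<in> g ` {1..n} then inv_into {1..n} g l else 1)"
  have a: "a \<in> allocations n n"
    using n by (auto simp: allocations_def a_def inv_into_into[of _ g "{1..n}", simplified])
  have ag: "a (g i) = i" if "i \<in> {1..n}" for i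
    using g[OF that] that inv_into_f_f[OF inj that] by (auto simp: a_def)
  have "1 \<le> valuation (\<lambda>l. item_values n (\<tau> l)) i (assigned_items n a i)" if i: "i \<in> {1..n}" for i
  proof -
    have "{g i} \<subseteq> {l \<in> assigned_items n a i. i \<in> wanted_by (\<tau> l)}"
      using g[OF i] ag[OF i] by (auto simp: assigned_items_def)
    then have "card {g i} \<le> card {l \<in> assigned_items n a i. i \<in> wanted_by (\<tau> l)}"
      by (intro card_mono) (auto simp: assigned_items_def)
    then show ?thesis using i by (simp add: valuation_item_values assigned_items_def)
  qed
  then have "1 \<le> min_value n n (\<lambda>l. item_values n (\<tau> l)) a"
    unfolding min_value_def using n by (subst Min_ge_iff) auto
  also have "\<dots> \<le> OPT n n (\<lambda>l. item_values n (\<tau> l))" by (rule min_value_le_OPT[OF a])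
  finally show ?thesis using \<open>opt_potential n \<tau> n = 1\<close> by simp
qed

text \<open>A lower bound on the Bochner integral cannot rely on the default \<open>0\<close> of a
  non-integrable function. \<open>OPT\<close> is a finite maximum of minima of sums of
  coordinates.\<close>

lemma OPT_measurable: "OPT n m \<in> borel_measurable (PiM {1..m} (\<lambda>_. value_space n))"
proof -
  have coord: "(\<lambda>\<sigma>. \<sigma> l i) \<in> borel_measurable (PiM {1..m} (\<lambda>_. value_space n))"
    if "l \<in> {1..m}" "i \<in> {1..n}" for l i
  proof -
    have "(\<lambda>\<sigma>. \<sigma> l) \<in> measurable (PiM {1..m} (\<lambda>_. value_space n)) (value_space n)"
      using that by measurable
    moreover have "(\<lambda>v. v i) \<in> measurable (value_space n) (restrict_space borel {0..1::real})"
      unfolding value_space_def using that by measurable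
    moreover have "(\<lambda>x. x) \<in> measurable (restrict_space borel {0..1::real}) borel"
      by (simp add: measurable_restrict_space1)
    ultimately show ?thesis by (auto dest: measurable_compose)
  qed
  have "(\<lambda>\<sigma>. valuation \<sigma> i (assigned_items m a i)) \<in> borel_measurable (PiM {1..m} (\<lambda>_. value_space n))"
    if "i \<in> {1..n}" for a i
    unfolding valuation_def assigned_items_def using that by (intro borel_measurable_sum coord) auto
  then have "(\<lambda>\<sigma>. min_value n m \<sigma> a) \<in> borel_measurable (PiM {1..m} (\<lambda>_. value_space n))" for a
    unfolding min_value_def by (intro borel_measurable_Min) auto
  then have "(\<lambda>\<sigma>. OPT n m \<sigma>) \<in> borel_measurable (PiM {1..m} (\<lambda>_. value_space n))"
    unfolding OPT_def allocations_def by (intro borel_measurable_Max) (auto simp: finite_PiE)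
  then show ?thesis by simp
qed

lemma OPT_cong:
  assumes "\<And>l. l \<in> {1..m} \<Longrightarrow> \<sigma> l = \<sigma>' l"
  shows "OPT n m \<sigma> = OPT n m \<sigma>'"
proof -
  have "min_value n m \<sigma> = min_value n m \<sigma>'"
    using min_value_cong[of m \<sigma> \<sigma>' n] assms by blast
  then show ?thesis by (simp add: OPT_def)
qed

lemma expected_OPT_ge:
  assumes n: "n \<ge> 1"
  shows "fact n * (7 / 2) ^ (n div 2) / real (card (types n)) ^ n \<le> expected_OPT n n (pair_distribution n)"
proof -
  have "fact n * (7 / 2) ^ (n div 2) = (\<Sum>\<tau>\<in>{1..n} \<rightarrow>\<^sub>E types n. opt_potential n \<tau> n)"
    using sum_opt_potential[of n n] by simp
  also have "\<dots> \<le> (\<Sum>\<tau>\<in>{1..n} \<rightarrow>\<^sub>E types n. OPT n n (\<lambda>l. item_values n (\<tau> l)))"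
    by (intro sum_mono opt_potential_le_OPT n)
  also have "\<dots> = (\<Sum>\<tau>\<in>{1..n} \<rightarrow>\<^sub>E types n. OPT n n (\<lambda>l\<in>{1..n}. item_values n (\<tau> l)))"
    by (intro sum.cong refl OPT_cong) simp
  finally show ?thesis
    unfolding expected_OPT_def integral_pair_input[OF n OPT_measurable] by (rule divide_right_mono) simp
qed

section \<open>Comparison of the two bounds\<close>

lemma six_sevenths_power_le:
  assumes "n \<ge> 30"
  shows "(6 / 7 :: real) ^ (n div 2) \<le> 1 / exp (1 / 28 * real n)"
proof -
  \<comment> \<open>\<open>6 / 7 = 1 + (- 1 / 7)\<close>, and \<open>1 + x\<close> is at most
    \<open>exp x\<close>.\<close>
  have "(6 / 7 :: real) ^ (n div 2) \<le> exp (- 1 / 7) ^ (n div 2)"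
    using exp_ge_add_one_self[of "- 1 / 7"] by (intro power_mono) auto
  also have "\<dots> = exp (- real (n div 2) / 7)" by (simp flip: exp_of_nat_mult)
  also have "\<dots> \<le> exp (- (1 / 28 * real n))"
  proof -
    \<comment> \<open>\<open>n div 2\<close> is at least \<open>n / 4\<close>, which turns the rate
      \<open>1 / 7\<close> per pair into \<open>1 / 28\<close> per agent.\<close>
    have "n \<le> 4 * (n div 2)" using assms by linarith
    then have "real n \<le> 4 * real (n div 2)" by linarith
    then show ?thesis by simp
  qed
  finally show ?thesis by (simp add: exp_minus inverse_eq_divide)
qed

theorem theorem9:
  "\<exists>\<kappa>::real. \<kappa> > 0 \<and> (\<exists>n0::nat. \<forall>n\<ge>n0. \<exists>(D :: (nat \<Rightarrow> real) measure) (m :: nat).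
     value_distribution n D \<and>
     expected_OPT n m D > 0 \<and>
     (\<forall>alg. online_algorithm n m alg \<longrightarrow>
        expected_ALG n m D alg / expected_OPT n m D \<le> 1 / exp (\<kappa> * real n)))"
proof (intro exI[of _ "1 / 28"] exI[of _ 30] conjI allI impI)
  fix n :: nat assume n30: "n \<ge> 30"
  then have n: "n \<ge> 1" by simp
  let ?D = "pair_distribution n"
  \<comment> \<open>The factor common to both bounds, which cancels in the ratio.\<close>
  define C where "C = fact n / real (card (types n)) ^ n"
  have C: "C > 0" unfolding C_def using types_nonempty[OF n] by (simp add: card_gt_0_iff)
  have opt: "C * (7 / 2) ^ (n div 2) \<le> expected_OPT n n ?D"
    using expected_OPT_ge[OF n] by (simp add: C_def)
  moreover have "C * (7 / 2) ^ (n div 2) > 0" using C by simp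
  ultimately have pos: "expected_OPT n n ?D > 0" by linarith
  have "expected_ALG n n ?D alg / expected_OPT n n ?D \<le> 1 / exp (1 / 28 * real n)" for alg
  proof -
    have "expected_ALG n n ?D alg \<le> C * 3 ^ (n div 2)"
      using expected_ALG_le[OF n, of alg] by (simp add: C_def)
    \<comment> \<open>Uses \<open>3 = 6 / 7 * 7 / 2\<close> for each pair.\<close>
    also have "\<dots> = (6 / 7) ^ (n div 2) * (C * (7 / 2) ^ (n div 2))"
      by (simp flip: power_mult_distrib)
    also have "\<dots> \<le> (1 / exp (1 / 28 * real n)) * expected_OPT n n ?D"
      using opt C by (intro mult_mono six_sevenths_power_le n30) auto
    finally show ?thesis using pos by (simp add: divide_le_eq)
  qed
  with pos value_distribution_pair show "\<exists>D m. value_distribution n D \<and> expected_OPT n m D > 0 \<and>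
     (\<forall>alg. online_algorithm n m alg \<longrightarrow>
        expected_ALG n m D alg / expected_OPT n m D \<le> 1 / exp (1 / 28 * real n))"
    by blast
qed simp

end
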